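(* Consider the regression model $y=X\beta+\epsilon$ with $\epsilon\sim\mathcal E_n(0,\sigma^2V,g)$, and the quadratic risk $R(\beta^*;\beta)=E[(\beta^*-\beta)'\mathbf W(\beta^*-\beta)]$ for a given positive definite $p\times p$ matrix $\mathbf W$. Let $0<\alpha<1$ and let $$\hat\beta^{PT}=\tilde\beta\, I(\mathcal L_n\ge F_\alpha)+\hat\beta\, I(\mathcal L_n<F_\alpha)$$ be the preliminary test estimator, where $F_\alpha$ is the upper $\alpha$-th percentile of the central $F$-distribution with $(q,n-p)$ degrees of freedom. Then under $H_0:H\beta=h$, $$R(\hat\beta;\beta)\le R(\hat\beta^{PT};\beta)\le R(\tilde\beta;\beta).$$
   Context: Model: $y=X\beta+\epsilon$, where $X$ is a fixed $n\times p$ matrix of full column rank $p<n$, $V$ is a known positive definite $n\times n$ matrix, $\beta\in\mathbb R^p$ and $\sigma>0$ are unknown, and $\epsilon\sim\mathcal E_n(0,\sigma^2V,g)$ has density $|\sigma^2V|^{-1/2}g(\epsilon'V^{-1}\epsilon/\sigma^2)$ of the form $$f_\epsilon(x)=\int_0^\infty \phi_{N_n(0,t^{-1}\sigma^2V)}(x)\,\mathcal W(dt),$$ where $\phi_{N_n(0,\Sigma)}$ is the density of $N_n(0,\Sigma)$ and $\mathcal W$ is a (possibly signed) measure on $(0,\infty)$, not depending on $\beta,\sigma$, with $\int_0^\infty\mathcal W(dt)=1$ and with Jordan decomposition $\mathcal W=\mathcal W^+-\mathcal W^-$ satisfying $\int t^{-1}\mathcal W^\pm(dt)<\infty$. Estimators: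 $C=X'V^{-1}X$; $\tilde\beta=C^{-1}X'V^{-1}y$; $S^2=(y-X\tilde\beta)'V^{-1}(y-X\tilde\beta)/(n-p)$; $H$ is a known $q\times p$ matrix of full row rank $q<p$, $h\in\mathbb R^q$ is known, $V_1=(HC^{-1}H')^{-1}$; $\hat\beta=\tilde\beta-C^{-1}H'V_1(H\tilde\beta-h)$ (restricted estimator); $\mathcal L_n=(H\tilde\beta-h)'V_1(H\tilde\beta-h)/(qS^2)$. $I(\cdot)$ is the indicator function. *)

theory Defs
  imports "HOL-Probability.Probability"
begin

section \<open>Distributions\<close>

definition pos_def :: "real^'n^'n \<Rightarrow> bool" where
  "pos_def A \<longleftrightarrow> transpose A = A \<and> (\<forall>x. x \<noteq> 0 \<longrightarrow> x \<bullet> (A *v x) > 0)"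

definition mvn_density :: "real^'n \<Rightarrow> real^'n^'n \<Rightarrow> real^'n \<Rightarrow> real" where
  "mvn_density \<mu> \<Sigma> x =
     (2 * pi) powr (- real CARD('n) / 2) * det \<Sigma> powr (- 1 / 2) *
     exp (- ((x - \<mu>) \<bullet> (matrix_inv \<Sigma> *v (x - \<mu>))) / 2)"

definition elliptical_density ::
    "real^'n \<Rightarrow> real^'n^'n \<Rightarrow> (real \<Rightarrow> real) \<Rightarrow> real^'n \<Rightarrow> real" where
  "elliptical_density \<mu> \<Sigma> g x =
     det \<Sigma> powr (- 1 / 2) * g ((x - \<mu>) \<bullet> (matrix_inv \<Sigma> *v (x - \<mu>)))"

text \<open>\<open>elliptical M Y \<mu> \<Sigma> g\<close> says that \<open>Y\<close> has law \<open>E\<^sub>n(\<mu>, \<Sigma>, g)\<close>. The density generator has to be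
  nonnegative explicitly, because \<open>ennreal\<close> truncates negative values.\<close>

definition elliptical ::
    "'a measure \<Rightarrow> ('a \<Rightarrow> real^'n) \<Rightarrow> real^'n \<Rightarrow> real^'n^'n \<Rightarrow> (real \<Rightarrow> real) \<Rightarrow> bool" where
  "elliptical M Y \<mu> \<Sigma> g \<longleftrightarrow>
     (\<forall>u\<ge>0. 0 \<le> g u) \<and>
     distributed M lborel Y (\<lambda>x. ennreal (elliptical_density \<mu> \<Sigma> g x))"

definition F_density :: "nat \<Rightarrow> nat \<Rightarrow> real \<Rightarrow> real" where
  "F_density k m x =
     (if x \<le> 0 then 0
      else (real k / real m) powr (real k / 2) * x powr (real k / 2 - 1) *
           (1 + real k / real m * x) powr (- (real k + real m) / 2) /
           Beta (real k / 2) (real m / 2))"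

definition F_distribution :: "nat \<Rightarrow> nat \<Rightarrow> real measure" where
  "F_distribution k m = density lborel (\<lambda>x. ennreal (F_density k m x))"

section \<open>Signed mixing measures\<close>

definition signed_measure :: "'a measure \<Rightarrow> ('a set \<Rightarrow> real) \<Rightarrow> bool" where
  "signed_measure M \<mu> \<longleftrightarrow>
     \<mu> {} = 0 \<and>
     (\<forall>A :: nat \<Rightarrow> 'a set. range A \<subseteq> sets M \<longrightarrow> disjoint_family A \<longrightarrow>
        (\<lambda>i. \<mu> (A i)) sums \<mu> (\<Union>i. A i))"

definition jordan_decomposition ::
    "'a measure \<Rightarrow> ('a set \<Rightarrow> real) \<Rightarrow> 'a measure \<Rightarrow> 'a measure \<Rightarrow> bool" where
  "jordan_decomposition M \<mu> P N \<longleftrightarrow>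
     sets P = sets M \<and> sets N = sets M \<and> finite_measure P \<and> finite_measure N \<and>
     (\<forall>A\<in>sets M. \<mu> A = measure P A - measure N A) \<and>
     (\<exists>B\<in>sets M. measure P (space M - B) = 0 \<and> measure N B = 0)"

definition signed_integral :: "'a measure \<Rightarrow> 'a measure \<Rightarrow> ('a \<Rightarrow> real) \<Rightarrow> real" where
  "signed_integral P N f = (LINT t|P. f t) - (LINT t|N. f t)"

section \<open>Estimators\<close>

definition gram :: "real^'p^'n \<Rightarrow> real^'n^'n \<Rightarrow> real^'p^'p" where
  "gram X V = transpose X ** matrix_inv V ** X"

definition unrestricted_est :: "real^'p^'n \<Rightarrow> real^'n^'n \<Rightarrow> real^'n \<Rightarrow> real^'p" where
  "unrestricted_est X V y =
     (matrix_inv (gram X V) ** transpose X ** matrix_inv V) *v y"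

definition S2 :: "real^'p^'n \<Rightarrow> real^'n^'n \<Rightarrow> real^'n \<Rightarrow> real" where
  "S2 X V y =
     (let r = y - X *v unrestricted_est X V y
      in r \<bullet> (matrix_inv V *v r) / (real CARD('n) - real CARD('p)))"

definition V1 :: "real^'p^'n \<Rightarrow> real^'n^'n \<Rightarrow> real^'p^'q \<Rightarrow> real^'q^'q" where
  "V1 X V H = matrix_inv (H ** matrix_inv (gram X V) ** transpose H)"

definition restricted_est ::
    "real^'p^'n \<Rightarrow> real^'n^'n \<Rightarrow> real^'p^'q \<Rightarrow> real^'q \<Rightarrow> real^'n \<Rightarrow> real^'p" where
  "restricted_est X V H h y =
     unrestricted_est X V y -
     (matrix_inv (gram X V) ** transpose H ** V1 X V H) *v (H *v unrestricted_est X V y - h)"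

definition test_stat ::
    "real^'p^'n \<Rightarrow> real^'n^'n \<Rightarrow> real^'p^'q \<Rightarrow> real^'q \<Rightarrow> real^'n \<Rightarrow> real" where
  "test_stat X V H h y =
     (let d = H *v unrestricted_est X V y - h
      in d \<bullet> (V1 X V H *v d) / (real CARD('q) * S2 X V y))"

definition preliminary_test_est ::
    "real^'p^'n \<Rightarrow> real^'n^'n \<Rightarrow> real^'p^'q \<Rightarrow> real^'q \<Rightarrow> real \<Rightarrow> real^'n \<Rightarrow> real^'p" where
  "preliminary_test_est X V H h c y =
     indicator {z. test_stat X V H h z \<ge> c} y *\<^sub>R unrestricted_est X V y +
     indicator {z. test_stat X V H h z < c} y *\<^sub>R restricted_est X V H h y"

definition quadratic_risk ::
    "'a measure \<Rightarrow> real^'p^'p \<Rightarrow> ('a \<Rightarrow> real^'p) \<Rightarrow> real^'p \<Rightarrow> real" where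
  "quadratic_risk M Q b \<beta> = (LINT \<omega>|M. (b \<omega> - \<beta>) \<bullet> (Q *v (b \<omega> - \<beta>)))"

section \<open>The regression model\<close>

text \<open>The mixture representation of the density is required almost everywhere only: at \<open>x = 0\<close> the
  integrand is a multiple of \<open>t powr (n/2)\<close>, which need not be integrable, whereas for \<open>x \<noteq> 0\<close> it is
  bounded in \<open>t\<close>.\<close>

definition elliptical_regression ::
    "'a measure \<Rightarrow> real^'p^'n \<Rightarrow> real^'n^'n \<Rightarrow> (real \<Rightarrow> real) \<Rightarrow> (real set \<Rightarrow> real) \<Rightarrow>
     real measure \<Rightarrow> real measure \<Rightarrow> real^'p \<Rightarrow> real \<Rightarrow> ('a \<Rightarrow> real^'n) \<Rightarrow> ('a \<Rightarrow> real^'n) \<Rightarrow> bool" where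
  "elliptical_regression M X V g W Wp Wm \<beta> \<sigma> \<epsilon> y \<longleftrightarrow>
     prob_space M \<and>
     CARD('p) < CARD('n) \<and> rank X = CARD('p) \<and> pos_def V \<and> \<sigma> > 0 \<and>
     (\<forall>\<omega>\<in>space M. y \<omega> = X *v \<beta> + \<epsilon> \<omega>) \<and>
     elliptical M \<epsilon> 0 (\<sigma>\<^sup>2 *\<^sub>R V) g \<and>
     signed_measure (restrict_space borel {0<..}) W \<and> W {0<..} = 1 \<and>
     jordan_decomposition (restrict_space borel {0<..}) W Wp Wm \<and>
     integrable Wp (\<lambda>t. 1 / t) \<and> integrable Wm (\<lambda>t. 1 / t) \<and>
     (AE x in lborel. elliptical_density 0 (\<sigma>\<^sup>2 *\<^sub>R V) g x =
        signed_integral Wp Wm (\<lambda>t. mvn_density 0 ((\<sigma>\<^sup>2 / t) *\<^sub>R V) x))"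

end

theory Submission
  imports Defs
begin

text \<open>Let \<open>u = C\<^sup>-\<^sup>1H'V\<^sub>1HC\<^sup>-\<^sup>1X'V\<^sup>-\<^sup>1\<epsilon>\<close> be the difference of the unrestricted and the restricted
  estimator under \<open>H\<beta> = h\<close>. The map \<open>\<epsilon> \<mapsto> \<epsilon> - 2Xu\<close> is linear and preserves the form \<open>\<epsilon>'V\<^sup>-\<^sup>1\<epsilon>\<close>, hence it
  preserves the law of \<open>\<epsilon>\<close>. It changes the sign of \<open>u\<close> but fixes the error \<open>w\<close> of the restricted
  estimator and the test statistic. The cross terms between \<open>w\<close> and \<open>u\<close> therefore have mean zero, with
  or without the indicator of rejection, and the three risks differ only by the expectations of
  \<open>0 \<le> I\<cdot>u'Qu \<le> u'Qu\<close>. All expectations exist because the density is at most the normal mixture with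
  respect to \<open>\<W>\<^sup>+\<close>, whose second moment is a multiple of \<open>\<integral>t\<^sup>-\<^sup>1d\<W>\<^sup>+\<close>.\<close>

section \<open>Gaussian integrals and linear isometries\<close>

lemma nn_integral_gaussian_real:
  fixes a :: real
  assumes "0 < a"
  shows "(\<integral>\<^sup>+x. ennreal (exp (- a * x\<^sup>2)) \<partial>lborel) = ennreal (sqrt (pi / a))"
proof -
  \<comment> \<open>The standard deviation for which 1/(2 s^2) = a, so that the integrand is a
    multiple of a probability density.\<close>
  define s where "s = sqrt (1 / (2 * a))"
  have s: "0 < s" "s\<^sup>2 = 1 / (2 * a)"
    using assms by (auto simp: s_def)
  interpret N: prob_space "density lborel (\<lambda>x. ennreal (normal_density 0 s x))"
    using s by (intro prob_space_normal_density)
  have N: "(\<integral>\<^sup>+x. ennreal (normal_density 0 s x) \<partial>lborel) = 1"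
    using N.emeasure_space_1 by (simp add: emeasure_density)
  have "exp (- a * x\<^sup>2) = sqrt (pi / a) * normal_density 0 s x" for x
    using assms by (simp add: normal_density_def s field_simps)
  then have "(\<integral>\<^sup>+x. ennreal (exp (- a * x\<^sup>2)) \<partial>lborel) =
      (\<integral>\<^sup>+x. ennreal (sqrt (pi / a)) * ennreal (normal_density 0 s x) \<partial>lborel)"
    using assms by (intro nn_integral_cong) (simp add: ennreal_mult)
  also have "\<dots> = ennreal (sqrt (pi / a))"
    by (subst nn_integral_cmult) (auto simp: N)
  finally show ?thesis .
qed

text \<open>The integrand is a product over the coordinates, so the integral is a power of the
  one-dimensional one.\<close>

lemma nn_integral_gaussian:
  fixes a :: real
  assumes "0 < a"
  shows "(\<integral>\<^sup>+x. ennreal (exp (- a * (norm (x::'a::euclidean_space))\<^sup>2)) \<partial>lborel)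
    = ennreal (sqrt (pi / a) ^ DIM('a))"
proof -
  have "exp (- a * (norm x)\<^sup>2) = (\<Prod>b\<in>Basis. exp (- a * (x \<bullet> b)\<^sup>2))" for x :: 'a
    unfolding power2_norm_eq_inner euclidean_inner[of x x]
    by (simp add: exp_sum[symmetric] sum_distrib_left power2_eq_square)
  then have "(\<integral>\<^sup>+x. ennreal (exp (- a * (norm (x::'a))\<^sup>2)) \<partial>lborel)
      = (\<integral>\<^sup>+x. (\<Prod>b\<in>Basis. ennreal (exp (- a * ((x::'a) \<bullet> b)\<^sup>2))) \<partial>lborel)"
    by (intro nn_integral_cong) (simp add: prod_ennreal)
  also have "\<dots> = (\<Prod>b\<in>(Basis::'a set). (\<integral>\<^sup>+x. ennreal (exp (- a * x\<^sup>2)) \<partial>lborel))"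
    using nn_integral_lborel_prod[of "\<lambda>(b::'a) x. ennreal (exp (- a * x\<^sup>2))"] by simp
  also have "\<dots> = ennreal (sqrt (pi / a) ^ DIM('a))"
    using assms by (simp only: nn_integral_gaussian_real prod_constant) (simp add: ennreal_power)
  finally show ?thesis .
qed

text \<open>Half of the exponent is spent on absorbing the factor |x|^2. The constant is crude, but
  its order in \<open>a\<close> is the true one: the extra factor 1/a is what later becomes a
  multiple of 1/t.\<close>

lemma nn_integral_norm_sq_gaussian_le:
  fixes a :: real
  assumes "0 < a"
  shows "(\<integral>\<^sup>+x. ennreal ((norm (x::'a::euclidean_space))\<^sup>2 * exp (- a * (norm x)\<^sup>2)) \<partial>lborel)
    \<le> ennreal (2 / a * sqrt (2 * pi / a) ^ DIM('a))"
proof -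
  have *: "(norm x)\<^sup>2 * exp (- a * (norm x)\<^sup>2) \<le> 2 / a * exp (- (a / 2) * (norm x)\<^sup>2)" for x :: 'a
  proof -
    define s where "s = a / 2 * (norm x)\<^sup>2"
    have "s \<le> exp s"
      using exp_ge_add_one_self[of s] by linarith
    then have "s * exp (- 2 * s) \<le> exp s * exp (- 2 * s)"
      by (intro mult_right_mono) auto
    also have "\<dots> = exp (- s)"
      by (simp add: exp_add[symmetric])
    finally have "2 / a * (s * exp (- 2 * s)) \<le> 2 / a * exp (- s)"
      using assms by (intro mult_left_mono) auto
    then show ?thesis
      using assms by (simp add: s_def field_simps)
  qed
  have "(\<integral>\<^sup>+x. ennreal ((norm (x::'a))\<^sup>2 * exp (- a * (norm x)\<^sup>2)) \<partial>lborel)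
      \<le> (\<integral>\<^sup>+x. ennreal (2 / a) * ennreal (exp (- (a / 2) * (norm (x::'a))\<^sup>2)) \<partial>lborel)"
    using assms *
    by (intro nn_integral_mono) (auto simp: ennreal_mult[symmetric] simp del: ennreal_le_iff intro!: ennreal_leI)
  also have "\<dots> = ennreal (2 / a) * (\<integral>\<^sup>+x. ennreal (exp (- (a / 2) * (norm (x::'a))\<^sup>2)) \<partial>lborel)"
    by (rule nn_integral_cmult) auto
  also have "\<dots> = ennreal (2 / a) * ennreal (sqrt (pi / (a / 2)) ^ DIM('a))"
    using assms by (subst nn_integral_gaussian) auto
  also have "\<dots> = ennreal (2 / a * sqrt (2 * pi / a) ^ DIM('a))"
    using assms by (simp add: ennreal_mult[symmetric] mult.commute)
  finally show ?thesis .
qed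

lemma nn_integral_lborel_translate:
  fixes c :: "'a::euclidean_space"
  assumes [measurable]: "f \<in> borel_measurable borel"
  shows "(\<integral>\<^sup>+x. f (c + x) \<partial>lborel) = (\<integral>\<^sup>+x. f x \<partial>lborel)"
proof -
  have "(\<integral>\<^sup>+x. f x \<partial>lborel) = (\<integral>\<^sup>+x. f x \<partial>distr lborel borel ((+) c))"
    by (simp add: lborel_distr_plus)
  also have "\<dots> = (\<integral>\<^sup>+x. f (c + x) \<partial>lborel)"
    by (subst nn_integral_distr) auto
  finally show ?thesis by simp
qed

lemma borel_measurable_linear:
  fixes f :: "'a::euclidean_space \<Rightarrow> 'b::real_normed_vector"
  shows "linear f \<Longrightarrow> f \<in> borel_measurable borel"
  by (simp add: borel_measurable_continuous_onI linear_continuous_on linear_conv_bounded_linear)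

section \<open>Positive definite forms and their linear isometries\<close>

lemma pos_def_pos: "pos_def A \<Longrightarrow> x \<noteq> 0 \<Longrightarrow> 0 < x \<bullet> (A *v x)"
  and pos_def_symmetric: "pos_def A \<Longrightarrow> transpose A = A"
  by (auto simp: pos_def_def)

lemma pos_def_nonneg: "pos_def A \<Longrightarrow> 0 \<le> x \<bullet> (A *v x)"
  by (cases "x = 0") (auto simp: less_imp_le pos_def_pos)

text \<open>The constant is the minimum of the form on the compact unit sphere; homogeneity of
  degree two extends the bound to all vectors.\<close>

lemma pos_def_coercive:
  fixes A :: "real^'n^'n"
  assumes "pos_def A"
  obtains c where "0 < c" "\<And>x. c * (norm x)\<^sup>2 \<le> x \<bullet> (A *v x)"
proof -
  have "continuous_on (sphere 0 1) (\<lambda>x. x \<bullet> (A *v x))"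
    by (intro continuous_intros matrix_vector_mult_linear_continuous_on)
  moreover have "sphere (0::real^'n) 1 \<noteq> {}"
    by simp
  ultimately obtain z where z: "z \<in> sphere 0 1"
      "\<And>y. y \<in> sphere 0 1 \<Longrightarrow> z \<bullet> (A *v z) \<le> y \<bullet> (A *v y)"
    using continuous_attains_inf[OF compact_sphere, of 0 1 "\<lambda>x. x \<bullet> (A *v x)"] by blast
  have "z \<noteq> 0"
    using z(1) by auto
  then have "0 < z \<bullet> (A *v z)"
    by (rule pos_def_pos[OF assms])
  moreover have "(z \<bullet> (A *v z)) * (norm x)\<^sup>2 \<le> x \<bullet> (A *v x)" for x
  proof (cases "x = 0")
    case False
    have "z \<bullet> (A *v z) \<le> (x /\<^sub>R norm x) \<bullet> (A *v (x /\<^sub>R norm x))"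
      using False by (intro z) auto
    also have "\<dots> = (x \<bullet> (A *v x)) / (norm x)\<^sup>2"
      by (simp add: matrix_vector_mult_scaleR power2_eq_square divide_inverse mult_ac)
    finally show ?thesis
      using False by (simp add: field_simps)
  qed auto
  ultimately show thesis
    by (rule that)
qed

text \<open>The uniqueness proof for Haar measure, run with a test function \<open>G\<close> that is itself invariant
  under \<open>T\<close>: this yields the constant 1 directly and no determinant is needed.\<close>

lemma nn_integral_lborel_isometry:
  fixes A :: "real^'n^'n" and T :: "real^'n \<Rightarrow> real^'n"
  assumes A: "pos_def A" and T: "linear T"
    and inv: "\<And>x. T x \<bullet> (A *v T x) = x \<bullet> (A *v x)"
    and f[measurable]: "f \<in> borel_measurable borel"
  shows "(\<integral>\<^sup>+x. f (T x) \<partial>lborel) = (\<integral>\<^sup>+x. f x \<partial>lborel)"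
proof -
  define G where "G x = ennreal (exp (- (x \<bullet> (A *v x))))" for x
  have [measurable]: "T \<in> borel_measurable borel"
    by (intro borel_measurable_linear T)
  have [measurable]: "(\<lambda>x. A *v x) \<in> borel_measurable borel"
    by (intro borel_measurable_linear matrix_vector_mul_linear)
  have [measurable]: "G \<in> borel_measurable borel"
    unfolding G_def by measurable
  \<comment> \<open>A kernel vector of \<open>T\<close> has form value 0 and hence vanishes. In
    finite dimension \<open>T\<close> is then also onto, so every \<open>y\<close> has the preimage
    \<open>inv T y\<close>.\<close>
  have "inj T"
  proof (rule linear_injective_0[OF T, THEN iffD2], intro allI impI)
    fix x assume "T x = 0"
    then show "x = 0"
      using inv[of x] pos_def_pos[OF A, of x] by force
  qed
  then have "surj T"
    using T by (simp add: linear_injective_imp_surjective)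
  then have inv_T: "T (inv T y) = y" for y
    by (rule surj_f_inv_f)
  obtain c where c: "0 < c" "\<And>x. c * (norm x)\<^sup>2 \<le> x \<bullet> (A *v x)"
    using pos_def_coercive[OF A] by blast
  have "(\<integral>\<^sup>+x. G x \<partial>lborel) \<le> (\<integral>\<^sup>+x. ennreal (exp (- c * (norm (x::real^'n))\<^sup>2)) \<partial>lborel)"
    using c(2) by (intro nn_integral_mono) (auto simp: G_def)
  also have "\<dots> < \<infinity>"
    using c(1) by (subst nn_integral_gaussian) auto
  finally have G_fin: "(\<integral>\<^sup>+x. G x \<partial>lborel) \<noteq> \<infinity>"
    by simp
  \<comment> \<open>\<open>G\<close> is positive everywhere, so a zero integral would make the whole
    space a null set.\<close>
  have G_pos: "(\<integral>\<^sup>+x. G x \<partial>lborel) \<noteq> 0"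
  proof
    assume "(\<integral>\<^sup>+x. G x \<partial>lborel) = 0"
    then have "AE x in lborel. G x = 0"
      by (subst (asm) nn_integral_0_iff_AE) auto
    then have "AE x in (lborel :: (real^'n) measure). False"
      by eventually_elim (simp add: G_def)
    then have "emeasure lborel (UNIV :: (real^'n) set) = 0"
      by (simp add: AE_iff_measurable[OF _ refl])
    then show False
      by (simp add: emeasure_lborel_UNIV)
  qed
  \<comment> \<open>Shifting \<open>x\<close> by \<open>inv T y\<close> moves \<open>y\<close> into
    the argument of \<open>f\<close>; after exchanging the integrals, shifting \<open>y\<close> by
    \<open>T x\<close> moves \<open>T x\<close> into the argument of \<open>G\<close>. There the
    invariance of \<open>G\<close> removes \<open>T\<close>.\<close>
  have "(\<integral>\<^sup>+x. f (T x) \<partial>lborel) * (\<integral>\<^sup>+y. G y \<partial>lborel)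
      = (\<integral>\<^sup>+y. (\<integral>\<^sup>+x. f (T x) * G y \<partial>lborel) \<partial>lborel)"
    by (simp add: nn_integral_multc nn_integral_cmult)
  also have "\<dots> = (\<integral>\<^sup>+y. (\<integral>\<^sup>+x. f (T x + y) * G y \<partial>lborel) \<partial>lborel)"
  proof (rule nn_integral_cong)
    fix y
    have "(\<integral>\<^sup>+x. f (T x) * G y \<partial>lborel) = (\<integral>\<^sup>+x. f (T (inv T y + x)) * G y \<partial>lborel)"
      using nn_integral_lborel_translate[of "\<lambda>x. f (T x) * G y" "inv T y"] by simp
    then show "(\<integral>\<^sup>+x. f (T x) * G y \<partial>lborel) = (\<integral>\<^sup>+x. f (T x + y) * G y \<partial>lborel)"
      by (simp add: linear_add[OF T] inv_T add.commute)
  qed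
  also have "\<dots> = (\<integral>\<^sup>+x. (\<integral>\<^sup>+y. f (T x + y) * G y \<partial>lborel) \<partial>lborel)"
    by (rule lborel_pair.Fubini') measurable
  also have "\<dots> = (\<integral>\<^sup>+x. (\<integral>\<^sup>+y. f y * G (y - T x) \<partial>lborel) \<partial>lborel)"
  proof (rule nn_integral_cong)
    fix x
    show "(\<integral>\<^sup>+y. f (T x + y) * G y \<partial>lborel) = (\<integral>\<^sup>+y. f y * G (y - T x) \<partial>lborel)"
      using nn_integral_lborel_translate[of "\<lambda>y. f y * G (y - T x)" "T x"] by simp
  qed
  also have "\<dots> = (\<integral>\<^sup>+y. (\<integral>\<^sup>+x. f y * G (y - T x) \<partial>lborel) \<partial>lborel)"
    by (rule lborel_pair.Fubini') measurable
  also have "\<dots> = (\<integral>\<^sup>+y. (\<integral>\<^sup>+x. f y * G x \<partial>lborel) \<partial>lborel)"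
  proof (rule nn_integral_cong)
    fix y
    \<comment> \<open>Invariance pulls the argument back along \<open>T\<close> and evenness of
      \<open>G\<close> flips its sign, which leaves a translation in \<open>x\<close>.\<close>
    have "G (y - T x) = G (- inv T y + x)" for x
    proof -
      have "y - T x = T (inv T y - x)"
        by (simp add: linear_diff[OF T] inv_T)
      then have "G (y - T x) = G (inv T y - x)"
        by (simp add: G_def inv)
      also have "inv T y - x = - (- inv T y + x)"
        by simp
      also have "G \<dots> = G (- inv T y + x)"
        unfolding G_def by (simp only: linear_neg[OF matrix_vector_mul_linear] inner_minus_left inner_minus_right minus_minus)
      finally show ?thesis .
    qed
    then show "(\<integral>\<^sup>+x. f y * G (y - T x) \<partial>lborel) = (\<integral>\<^sup>+x. f y * G x \<partial>lborel)"
      using nn_integral_lborel_translate[of "\<lambda>x. f y * G x" "- inv T y"] by simp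
  qed
  also have "\<dots> = (\<integral>\<^sup>+y. f y \<partial>lborel) * (\<integral>\<^sup>+x. G x \<partial>lborel)"
    by (simp add: nn_integral_multc nn_integral_cmult)
  \<comment> \<open>Cancelling the integral of \<open>G\<close> in \<open>ennreal\<close> requires
    it to be both nonzero and finite.\<close>
  finally have "(\<integral>\<^sup>+x. f (T x) \<partial>lborel) * (\<integral>\<^sup>+x. G x \<partial>lborel) / (\<integral>\<^sup>+x. G x \<partial>lborel)
      = (\<integral>\<^sup>+x. f x \<partial>lborel) * (\<integral>\<^sup>+x. G x \<partial>lborel) / (\<integral>\<^sup>+x. G x \<partial>lborel)"
    by simp
  then show ?thesis
    using G_fin G_pos by (simp add: ennreal_mult_divide_eq)
qed

section \<open>Matrix algebra\<close>

lemma inner_matrix_vector: "x \<bullet> (A *v y) = (transpose A *v x) \<bullet> (y::real^'n)"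
  for A :: "real^'n^'m"
  by (simp add: dot_lmul_matrix)

lemma matrix_inv_mult:
  fixes A :: "real^'n^'n"
  assumes "invertible A"
  shows "A ** matrix_inv A = mat 1" "matrix_inv A ** A = mat 1"
  using someI_ex[OF assms[unfolded invertible_def]] unfolding matrix_inv_def by blast+

lemma matrix_inv_unique:
  fixes A :: "real^'n^'n"
  assumes "A ** B = mat 1"
  shows "matrix_inv A = B"
proof -
  have "invertible A"
    using assms invertible_right_inverse by blast
  then have "matrix_inv A ** (A ** B) = B"
    by (simp add: matrix_mul_assoc matrix_inv_mult)
  then show ?thesis
    using assms by simp
qed

lemma pos_def_invertible:
  fixes A :: "real^'n^'n"
  assumes "pos_def A"
  shows "invertible A"
  unfolding invertible_left_inverse matrix_left_invertible_ker
  using pos_def_pos[OF assms] by force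

text \<open>With x = A z, the form of the inverse at \<open>x\<close> is the form of
  \<open>A\<close> at \<open>z\<close>. Symmetry follows from uniqueness of inverses.\<close>

lemma pos_def_matrix_inv:
  fixes A :: "real^'n^'n"
  assumes "pos_def A"
  shows "pos_def (matrix_inv A)"
proof -
  note inv = matrix_inv_mult[OF pos_def_invertible[OF assms]]
  have "A ** transpose (matrix_inv A) = transpose (matrix_inv A ** A)"
    using pos_def_symmetric[OF assms] by (simp add: matrix_transpose_mul)
  then have "transpose (matrix_inv A) = matrix_inv A"
    by (intro matrix_inv_unique[symmetric]) (simp add: inv transpose_mat)
  moreover have "0 < x \<bullet> (matrix_inv A *v x)" if "x \<noteq> 0" for x
  proof -
    define z where "z = matrix_inv A *v x"
    have x: "x = A *v z"
      by (simp add: z_def matrix_vector_mul_assoc inv)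
    with that have "z \<noteq> 0"
      by auto
    then have "0 < z \<bullet> (A *v z)"
      by (rule pos_def_pos[OF assms])
    then show ?thesis
      by (simp add: z_def[symmetric] x[symmetric] inner_commute)
  qed
  ultimately show ?thesis
    by (simp add: pos_def_def)
qed

text \<open>Serves twice: with B = X for the Gram matrix, and with B = H' for the matrix whose
  inverse is \<open>V1\<close>.\<close>

lemma pos_def_congruence:
  fixes A :: "real^'n^'n" and B :: "real^'m^'n"
  assumes A: "pos_def A" and B: "inj ((*v) B)"
  shows "pos_def (transpose B ** A ** B)"
proof -
  have "0 < x \<bullet> ((transpose B ** A ** B) *v x)" if "x \<noteq> 0" for x
  proof -
    have "B *v x \<noteq> B *v 0"
      using B that by (meson injD)
    then have "0 < (B *v x) \<bullet> (A *v (B *v x))"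
      by (intro pos_def_pos[OF A]) simp
    then show ?thesis
      by (simp add: inner_matrix_vector[of x] matrix_vector_mul_assoc[symmetric] del: transpose_matrix_vector)
  qed
  then show ?thesis
    using pos_def_symmetric[OF A] by (simp add: pos_def_def matrix_transpose_mul matrix_mul_assoc)
qed

lemma matrix_inv_scaleR:
  fixes A :: "real^'n^'n"
  assumes "invertible A" "c \<noteq> 0"
  shows "matrix_inv (c *\<^sub>R A) = (1 / c) *\<^sub>R matrix_inv A"
proof (rule matrix_inv_unique)
  have "(c *\<^sub>R A) ** ((1 / c) *\<^sub>R matrix_inv A) = (c * (1 / c)) *\<^sub>R (A ** matrix_inv A)"
    by (simp add: vec_eq_iff matrix_matrix_mult_def sum_distrib_left mult_ac)
  then show "(c *\<^sub>R A) ** ((1 / c) *\<^sub>R matrix_inv A) = mat 1"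
    using assms by (simp add: matrix_inv_mult)
qed

text \<open>Scaling is multiplication by a scalar matrix, whose determinant is the power of
  \<open>c\<close>.\<close>

lemma det_scaleR: "det (c *\<^sub>R A) = c ^ CARD('n) * det A"
  for A :: "real^'n^'n"
proof -
  have "c *\<^sub>R A = matrix ((*\<^sub>R) c) ** A"
    by (simp add: matrix_scaleR vec_eq_iff matrix_matrix_mult_def mat_def if_distrib[of "\<lambda>x. x * _"] cong: if_cong)
  then show ?thesis
    by (simp add: det_mul del: matrix_scaleR)
qed

section \<open>Second moments of normal mixtures\<close>

text \<open>Makes the dependence on the scale explicit, with constants uniform in \<open>s\<close>
  and \<open>x\<close>. The bound is visibly measurable in both variables jointly, as the later
  exchange of integrals demands.\<close>

lemma mvn_density_scaleR_le:
  fixes V :: "real^'n^'n"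
  assumes "pos_def V"
  obtains K c where "0 \<le> K" "0 < c"
    "\<And>s x. 0 < s \<Longrightarrow>
       mvn_density 0 (s *\<^sub>R V) x \<le> K * sqrt (1 / s) ^ CARD('n) * exp (- (c / s) * (norm x)\<^sup>2)"
proof -
  obtain c where c: "0 < c" "\<And>x. c * (norm x)\<^sup>2 \<le> x \<bullet> (matrix_inv V *v x)"
    using pos_def_coercive[OF pos_def_matrix_inv[OF assms]] by blast
  define K where "K = (2 * pi) powr (- real CARD('n) / 2) * det V powr (- 1 / 2)"
  \<comment> \<open>The normal exponent carries a factor 1/2, hence the witness
    \<open>c / 2\<close>.\<close>
  have "mvn_density 0 (s *\<^sub>R V) x \<le> K * sqrt (1 / s) ^ CARD('n) * exp (- (c / 2 / s) * (norm x)\<^sup>2)"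
    if s: "0 < s" for s x
  proof -
    have "det (s *\<^sub>R V) powr (- 1 / 2) = (s ^ CARD('n)) powr (- (1 / 2)) * det V powr (- 1 / 2)"
      by (simp add: det_scaleR powr_mult)
    also have "(s ^ CARD('n)) powr (- (1 / 2)) = sqrt (1 / s) ^ CARD('n)"
      using s by (simp add: powr_minus powr_half_sqrt real_sqrt_power real_sqrt_divide power_divide divide_simps)
    finally have "mvn_density 0 (s *\<^sub>R V) x =
        K * sqrt (1 / s) ^ CARD('n) * exp (- (x \<bullet> (matrix_inv V *v x)) / (2 * s))"
      using s by (simp add: mvn_density_def K_def matrix_inv_scaleR[OF pos_def_invertible[OF assms]]
          scaleR_matrix_vector_assoc[symmetric] mult_ac)
    also have "\<dots> \<le> K * sqrt (1 / s) ^ CARD('n) * exp (- (c / 2 / s) * (norm x)\<^sup>2)"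
      using s c(2)[of x] by (intro mult_left_mono) (auto simp: K_def field_simps)
    finally show ?thesis .
  qed
  moreover have "0 \<le> K" "0 < c / 2"
    using c(1) by (auto simp: K_def)
  ultimately show thesis
    by (rule that[rotated 2])
qed

text \<open>A non-integrable \<open>f\<close> has Bochner integral 0 by convention, so the bound
  holds in that case too. It lets the mixture be estimated before anything is known about its
  finiteness at a given point.\<close>

lemma ennreal_integral_le_nn_integral:
  assumes "\<And>x. 0 \<le> f x"
  shows "ennreal (\<integral>x. f x \<partial>M) \<le> (\<integral>\<^sup>+x. ennreal (f x) \<partial>M)"
proof (cases "integrable M f")
  case True
  then show ?thesis
    using assms by (simp add: nn_integral_eq_integral)
qed (simp add: not_integrable_integral_eq)

lemma mvn_density_nonneg: "0 \<le> mvn_density \<mu> \<Sigma> x"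
  by (simp add: mvn_density_def)

text \<open>By Tonelli the moment can be computed for each fixed \<open>t\<close> first. There it is
  at most a constant times 1/t, which is integrable by assumption.\<close>

lemma mvn_mixture_second_moment_finite:
  fixes V :: "real^'n^'n"
  assumes V: "pos_def V" and \<sigma>: "0 < \<sigma>"
    and P: "finite_measure P" "sets P = sets (restrict_space borel {0<..})"
    and int: "integrable P (\<lambda>t. 1 / t)"
  shows "(\<integral>\<^sup>+x. ennreal ((norm x)\<^sup>2) * (\<integral>\<^sup>+t. ennreal (mvn_density 0 ((\<sigma>\<^sup>2 / t) *\<^sub>R V) x) \<partial>P) \<partial>lborel) < \<infinity>"
proof -
  interpret finite_measure P by (rule P)
  interpret pair_sigma_finite P "lborel :: (real^'n) measure" ..
  have space: "space P = {0<..}"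
    using sets_eq_imp_space_eq[OF P(2)] by (simp add: space_restrict_space)
  have [measurable]: "(\<lambda>t. t) \<in> borel_measurable P"
    unfolding measurable_cong_sets[OF P(2) refl] by (intro measurable_restrict_space1) simp
  obtain K c where K: "0 \<le> K" "0 < c" "\<And>s x. 0 < s \<Longrightarrow>
       mvn_density 0 (s *\<^sub>R V) x \<le> K * sqrt (1 / s) ^ CARD('n) * exp (- (c / s) * (norm x)\<^sup>2)"
    using mvn_density_scaleR_le[OF V] by blast
  define \<psi> where "\<psi> t x = ennreal (K * sqrt (1 / (\<sigma>\<^sup>2 / t)) ^ CARD('n) * exp (- (c / (\<sigma>\<^sup>2 / t)) * (norm x)\<^sup>2))"
    for t and x :: "real^'n"
  have [measurable]: "(\<lambda>(t, x). \<psi> t x) \<in> borel_measurable (P \<Otimes>\<^sub>M borel)"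
    unfolding \<psi>_def by measurable
  define B where "B = K * (2 * \<sigma>\<^sup>2 / c) * sqrt (2 * pi / c) ^ CARD('n)"
  have "0 \<le> B"
    using K by (simp add: B_def)
  have moment: "(\<integral>\<^sup>+x. ennreal ((norm x)\<^sup>2) * \<psi> t x \<partial>lborel) \<le> ennreal B * ennreal (1 / t)"
    if t: "0 < t" for t
  proof -
    define s where "s = \<sigma>\<^sup>2 / t"
    have s: "0 < s"
      using t \<sigma> by (simp add: s_def)
    have "(\<integral>\<^sup>+x. ennreal ((norm x)\<^sup>2) * \<psi> t x \<partial>lborel)
      = (\<integral>\<^sup>+x. ennreal (K * sqrt (1 / s) ^ CARD('n)) *
           ennreal ((norm (x::real^'n))\<^sup>2 * exp (- (c / s) * (norm x)\<^sup>2)) \<partial>lborel)"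
      using K s by (intro nn_integral_cong) (simp add: \<psi>_def s_def[symmetric] ennreal_mult[symmetric] mult_ac)
    also have "\<dots> = ennreal (K * sqrt (1 / s) ^ CARD('n)) *
        (\<integral>\<^sup>+x. ennreal ((norm (x::real^'n))\<^sup>2 * exp (- (c / s) * (norm x)\<^sup>2)) \<partial>lborel)"
      by (rule nn_integral_cmult) measurable
    also have "\<dots> \<le> ennreal (K * sqrt (1 / s) ^ CARD('n)) *
        ennreal (2 / (c / s) * sqrt (2 * pi / (c / s)) ^ DIM(real^'n))"
      using K s by (intro mult_left_mono nn_integral_norm_sq_gaussian_le) auto
    also have "\<dots> = ennreal (K * (2 * s / c) * (sqrt (1 / s) * sqrt (2 * pi / (c / s))) ^ CARD('n))"
      using K s by (simp add: ennreal_mult[symmetric] power_mult_distrib mult_ac)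
    \<comment> \<open>The normalising factor of the density cancels the volume growth of the
      Gaussian integral, so of all powers of \<open>s\<close> only the first remains.\<close>
    also have "sqrt (1 / s) * sqrt (2 * pi / (c / s)) = sqrt (2 * pi / c)"
      using s by (simp add: real_sqrt_mult[symmetric])
    also have "K * (2 * s / c) * sqrt (2 * pi / c) ^ CARD('n) = B * (1 / t)"
      by (simp add: B_def s_def)
    finally show ?thesis
      using t \<open>0 \<le> B\<close> by (simp add: ennreal_mult[symmetric])
  qed
  have "(\<integral>\<^sup>+x. ennreal ((norm x)\<^sup>2) * (\<integral>\<^sup>+t. ennreal (mvn_density 0 ((\<sigma>\<^sup>2 / t) *\<^sub>R V) x) \<partial>P) \<partial>lborel)
      \<le> (\<integral>\<^sup>+x. ennreal ((norm x)\<^sup>2) * (\<integral>\<^sup>+t. \<psi> t x \<partial>P) \<partial>lborel)"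
    using \<sigma> unfolding \<psi>_def
    by (intro nn_integral_mono mult_left_mono ennreal_leI K(3)) (auto simp: space)
  also have "\<dots> = (\<integral>\<^sup>+x. (\<integral>\<^sup>+t. ennreal ((norm x)\<^sup>2) * \<psi> t x \<partial>P) \<partial>lborel)"
    by (intro nn_integral_cong nn_integral_cmult[symmetric]) measurable
  also have "\<dots> = (\<integral>\<^sup>+t. (\<integral>\<^sup>+x. ennreal ((norm x)\<^sup>2) * \<psi> t x \<partial>lborel) \<partial>P)"
    using Fubini'[of "\<lambda>t x. ennreal ((norm x)\<^sup>2) * \<psi> t x"] by measurable
  also have "\<dots> \<le> (\<integral>\<^sup>+t. ennreal B * ennreal (1 / t) \<partial>P)"
    using moment by (intro nn_integral_mono) (auto simp: space)
  also have "\<dots> = ennreal B * (\<integral>\<^sup>+t. ennreal (1 / t) \<partial>P)"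
    by (rule nn_integral_cmult) measurable
  also have "(\<integral>\<^sup>+t. ennreal (1 / t) \<partial>P) = ennreal (\<integral>t. 1 / t \<partial>P)"
    using int by (intro nn_integral_eq_integral) (auto simp: space)
  also have "ennreal B * \<dots> < \<infinity>"
    by (simp add: ennreal_mult_less_top)
  finally show ?thesis .
qed

lemma elliptical_regression_second_moment_finite:
  assumes model: "elliptical_regression M X V g W Wp Wm \<beta> \<sigma> \<epsilon> y"
  shows "(\<integral>\<^sup>+\<omega>. ennreal ((norm (\<epsilon> \<omega>))\<^sup>2) \<partial>M) < \<infinity>"
proof -
  define f where "f = elliptical_density 0 (\<sigma>\<^sup>2 *\<^sub>R V) g"
  define m where "m x = (\<integral>\<^sup>+t. ennreal (mvn_density 0 ((\<sigma>\<^sup>2 / t) *\<^sub>R V) x) \<partial>Wp)" for x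
  have V: "pos_def V" and \<sigma>: "0 < \<sigma>"
    and D: "distributed M lborel \<epsilon> (\<lambda>x. ennreal (f x))"
    and mix: "AE x in lborel. f x = signed_integral Wp Wm (\<lambda>t. mvn_density 0 ((\<sigma>\<^sup>2 / t) *\<^sub>R V) x)"
    and Wp: "finite_measure Wp" "sets Wp = sets (restrict_space borel {0<..})" "integrable Wp (\<lambda>t. 1 / t)"
    using model unfolding elliptical_regression_def elliptical_def jordan_decomposition_def f_def by auto
  have "(\<integral>\<^sup>+\<omega>. ennreal ((norm (\<epsilon> \<omega>))\<^sup>2) \<partial>M) = (\<integral>\<^sup>+x. ennreal (f x) * ennreal ((norm x)\<^sup>2) \<partial>lborel)"
    by (rule distributed_nn_integral[OF D, symmetric]) measurable
  also have "\<dots> \<le> (\<integral>\<^sup>+x. ennreal ((norm x)\<^sup>2) * m x \<partial>lborel)"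
  proof (rule nn_integral_mono_AE)
    show "AE x in lborel. ennreal (f x) * ennreal ((norm x)\<^sup>2)
        \<le> ennreal ((norm x)\<^sup>2) * m x"
      using mix
    proof eventually_elim
      case (elim x)
      let ?\<phi> = "\<lambda>t. mvn_density 0 ((\<sigma>\<^sup>2 / t) *\<^sub>R V) x"
      \<comment> \<open>The part of the mixture with respect to \<open>Wm\<close> enters with a
        minus sign and is nonnegative, so dropping it only increases the bound.\<close>
      have "0 \<le> (\<integral>t. ?\<phi> t \<partial>Wm)"
        by (intro integral_nonneg_AE) (simp add: mvn_density_nonneg)
      then have "f x \<le> (\<integral>t. ?\<phi> t \<partial>Wp)"
        by (simp add: elim signed_integral_def)
      then have "ennreal (f x) \<le> ennreal (\<integral>t. ?\<phi> t \<partial>Wp)"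
        by (rule ennreal_leI)
      also have "\<dots> \<le> m x"
        unfolding m_def by (rule ennreal_integral_le_nn_integral) (rule mvn_density_nonneg)
      finally show ?case
        by (subst mult.commute) (rule mult_left_mono, auto)
    qed
  qed
  also have "\<dots> < \<infinity>"
    unfolding m_def by (rule mvn_mixture_second_moment_finite[OF V \<sigma> Wp])
  finally show ?thesis .
qed

section \<open>The reflection of the error vector\<close>

locale restricted_regression =
  fixes X :: "real^'p^'n" and V :: "real^'n^'n" and H :: "real^'p^'q"
  assumes X_rank: "rank X = CARD('p)" and V: "pos_def V" and H_rank: "rank H = CARD('q)"
begin

lemma gram_pos_def: "pos_def (gram X V)"
  unfolding gram_def
  using X_rank by (intro pos_def_congruence pos_def_matrix_inv V) (simp add: full_rank_injective)

text \<open>Full row rank of \<open>H\<close> makes its transpose injective, so H C^-1 H' is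
  positive definite and \<open>V1\<close> is its genuine inverse.\<close>

lemma V1_inverse: "pos_def (V1 X V H)"
  "(H ** matrix_inv (gram X V) ** transpose H) ** V1 X V H = mat 1"
proof -
  have "inj ((*v) (transpose H))"
    using H_rank by (simp add: full_rank_injective[symmetric] rank_transpose del: transpose_matrix_vector)
  from pos_def_congruence[OF pos_def_matrix_inv[OF gram_pos_def] this]
  have "pos_def (H ** matrix_inv (gram X V) ** transpose H)"
    by simp
  then show "pos_def (V1 X V H)" "(H ** matrix_inv (gram X V) ** transpose H) ** V1 X V H = mat 1"
    unfolding V1_def by (simp_all add: pos_def_matrix_inv matrix_inv_mult pos_def_invertible)
qed

text \<open>\<open>X *v correction e\<close> is the projection of \<open>e\<close>, orthogonal for
  the form of \<open>matrix_inv V\<close>, onto the range of X C^-1 H'. Within the column space of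
  \<open>X\<close> this range is the orthogonal complement of X(ker H).\<close>

definition correction :: "real^'n \<Rightarrow> real^'p" where
  "correction e = (matrix_inv (gram X V) ** transpose H ** V1 X V H) *v (H *v unrestricted_est X V e)"

text \<open>Subtracting the projection twice negates its range and fixes the orthogonal
  complement.\<close>

definition reflection :: "real^'n \<Rightarrow> real^'n" where
  "reflection e = e - 2 *\<^sub>R (X *v correction e)"

section \<open>Linearity, and the identities of a projection\<close>

lemma linear_unrestricted_est: "linear (unrestricted_est X V)"
  unfolding unrestricted_est_def by (rule matrix_vector_mul_linear)

lemma linear_correction: "linear correction"
proof -
  have "correction = (*v) (matrix_inv (gram X V) ** transpose H ** V1 X V H ** H) \<circ> unrestricted_est X V"
    by (simp add: fun_eq_iff correction_def matrix_vector_mul_assoc)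
  then show ?thesis
    by (metis linear_compose linear_unrestricted_est matrix_vector_mul_linear)
qed

lemma linear_reflection: "linear reflection"
proof -
  have "linear ((*v) X \<circ> correction)"
    by (intro linear_compose linear_correction matrix_vector_mul_linear)
  then show ?thesis
    unfolding reflection_def o_def
    by (intro linear_compose_sub linear_ident linear_compose_scale_right)
qed

lemma unrestricted_est_signal: "unrestricted_est X V (X *v b) = b"
proof -
  have "unrestricted_est X V (X *v b) = (matrix_inv (gram X V) ** gram X V) *v b"
    by (simp add: unrestricted_est_def gram_def matrix_vector_mul_assoc matrix_mul_assoc)
  then show ?thesis
    by (simp add: matrix_inv_mult pos_def_invertible gram_pos_def)
qed

lemma unrestricted_est_model: "unrestricted_est X V (X *v b + e) = b + unrestricted_est X V e"
  by (simp add: linear_add[OF linear_unrestricted_est] unrestricted_est_signal)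

lemma H_correction: "H *v correction e = H *v unrestricted_est X V e"
proof -
  have "H *v correction e
      = ((H ** matrix_inv (gram X V) ** transpose H) ** V1 X V H) *v (H *v unrestricted_est X V e)"
    unfolding correction_def by (simp only: matrix_vector_mul_assoc matrix_mul_assoc)
  then show ?thesis
    by (simp add: V1_inverse)
qed

text \<open>Idempotence: \<open>correction\<close> sees its argument only through \<open>H\<close>
  applied to the estimate, and on \<open>X *v correction e\<close> this value is the same as on
  \<open>e\<close>.\<close>

lemma correction_correction: "correction (X *v correction e) = correction e"
  unfolding correction_def[of "X *v correction e"]
  by (simp add: unrestricted_est_signal H_correction) (simp add: correction_def)

lemma correction_reflection: "correction (reflection e) = - correction e"
  unfolding reflection_def linear_diff[OF linear_correction] linear_scale[OF linear_correction]
    correction_correction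
  unfolding scaleR_2 by simp

lemma unrestricted_est_reflection:
  "unrestricted_est X V (reflection e) = unrestricted_est X V e - 2 *\<^sub>R correction e"
  by (simp add: reflection_def linear_diff[OF linear_unrestricted_est]
      linear_scale[OF linear_unrestricted_est] unrestricted_est_signal)

text \<open>For z = X u, an orthogonal projection of \<open>e\<close>, the products z'V^-1 z and
  z'V^-1 e agree; hence the terms -4 z'V^-1 e and 4 z'V^-1 z of the expansion cancel.\<close>

lemma reflection_isometry:
  "reflection e \<bullet> (matrix_inv V *v reflection e) = e \<bullet> (matrix_inv V *v e)"
proof -
  let ?z = "X *v correction e" and ?Vi = "matrix_inv V" and ?C = "gram X V"
  let ?d = "H *v unrestricted_est X V e"
  have C: "?C ** matrix_inv ?C = mat 1"
    by (simp add: matrix_inv_mult pos_def_invertible gram_pos_def)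
  have C_correction: "?C *v correction e = transpose H *v (V1 X V H *v ?d)"
    unfolding correction_def
    by (simp add: matrix_vector_mul_assoc matrix_mul_assoc C del: transpose_matrix_vector)
  have sym: "x \<bullet> (?Vi *v z) = z \<bullet> (?Vi *v x)" for x z
    using pos_def_symmetric[OF pos_def_matrix_inv[OF V]]
    by (metis inner_commute inner_matrix_vector)
  \<comment> \<open>The product depends on \<open>b\<close> only through \<open>H *v b\<close>, so
    it is the same for b = u and for the unrestricted estimate. This yields both \<open>zz\<close>
    and \<open>ze\<close>.\<close>
  have proj: "b \<bullet> (?C *v correction e) = (H *v b) \<bullet> (V1 X V H *v ?d)" for b
    unfolding C_correction inner_matrix_vector[of b] by simp
  have zz: "?z \<bullet> (?Vi *v ?z) = ?d \<bullet> (V1 X V H *v ?d)"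
  proof -
    have "?z \<bullet> (?Vi *v ?z) = correction e \<bullet> (?C *v correction e)"
      unfolding gram_def
      by (simp add: inner_matrix_vector[of "correction e"] matrix_vector_mul_assoc[symmetric]
          del: transpose_matrix_vector)
    then show ?thesis
      by (simp add: proj H_correction)
  qed
  have ze: "?z \<bullet> (?Vi *v e) = ?d \<bullet> (V1 X V H *v ?d)"
  proof -
    \<comment> \<open>The normal equations of generalized least squares.\<close>
    have "?C *v unrestricted_est X V e = transpose X *v (?Vi *v e)"
      unfolding unrestricted_est_def
      by (simp add: matrix_vector_mul_assoc matrix_mul_assoc C del: transpose_matrix_vector)
    then have "?z \<bullet> (?Vi *v e) = correction e \<bullet> (?C *v unrestricted_est X V e)"
      by (simp add: inner_matrix_vector[of "correction e"] del: transpose_matrix_vector)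
    also have "\<dots> = unrestricted_est X V e \<bullet> (?C *v correction e)"
      using pos_def_symmetric[OF gram_pos_def] by (metis inner_commute inner_matrix_vector)
    finally show ?thesis
      by (simp add: proj)
  qed
  have "reflection e \<bullet> (?Vi *v reflection e)
      = e \<bullet> (?Vi *v e) - 4 * (?z \<bullet> (?Vi *v e)) + 4 * (?z \<bullet> (?Vi *v ?z))"
    using sym[of e ?z]
    by (simp add: reflection_def matrix_vector_mult_diff_distrib matrix_vector_mult_scaleR
        inner_diff_left inner_diff_right algebra_simps)
  then show ?thesis
    by (simp add: zz ze)
qed

text \<open>When \<open>b\<close> satisfies the restriction, the discrepancy between
  \<open>H\<close> times the estimate and \<open>h\<close> comes from the error alone.\<close>

lemma restricted_est_model:
  assumes "H *v b = h"
  shows "restricted_est X V H h (X *v b + e) = b + (unrestricted_est X V e - correction e)"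
  using assms
  by (simp add: restricted_est_def correction_def unrestricted_est_model matrix_vector_right_distrib)

text \<open>The two indicators are complementary, so the estimator is the restricted one plus the
  correction on the event of rejection.\<close>

lemma preliminary_test_est_model:
  assumes "H *v b = h"
  shows "preliminary_test_est X V H h c (X *v b + e) = b + (unrestricted_est X V e - correction e)
    + indicator {z. test_stat X V H h z \<ge> c} (X *v b + e) *\<^sub>R correction e"
  by (auto simp: preliminary_test_est_def restricted_est_model[OF assms] unrestricted_est_model
      indicator_def)

text \<open>The error and its fitted value both move by -2 X u, so the residual and
  \<open>S2\<close> stay fixed. The numerator is an even function of a vector that changes
  sign.\<close>

lemma test_stat_reflection:
  assumes "H *v b = h"
  shows "test_stat X V H h (X *v b + reflection e) = test_stat X V H h (X *v b + e)"
proof -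
  have "S2 X V (X *v b + reflection e) = S2 X V (X *v b + e)"
    unfolding S2_def unrestricted_est_model unrestricted_est_reflection
    by (simp add: reflection_def matrix_vector_mult_diff_distrib matrix_vector_right_distrib
        matrix_vector_mult_scaleR algebra_simps)
  moreover have "H *v unrestricted_est X V (X *v b + reflection e) - h
      = - (H *v unrestricted_est X V (X *v b + e) - h)"
    unfolding unrestricted_est_model unrestricted_est_reflection matrix_vector_right_distrib
      matrix_vector_mult_diff_distrib matrix_vector_mult_scaleR H_correction assms
    unfolding scaleR_2 by simp
  ultimately show ?thesis
    unfolding test_stat_def Let_def
    by (simp only: linear_neg[OF matrix_vector_mul_linear] inner_minus_left inner_minus_right minus_minus)
qed

lemma borel_measurable_test_stat: "test_stat X V H h \<in> borel_measurable borel"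
proof -
  have [measurable]: "(*v) A \<in> borel_measurable borel" for A :: "real^'m^'k"
    by (intro borel_measurable_linear matrix_vector_mul_linear)
  show ?thesis
    unfolding test_stat_def S2_def unrestricted_est_def Let_def by measurable
qed

end

section \<open>Risk comparison\<close>

text \<open>The density depends on the form only, so \<open>T\<close> preserves it along with
  Lebesgue measure.\<close>

lemma elliptical_distr_isometry:
  fixes V :: "real^'n^'n" and T :: "real^'n \<Rightarrow> real^'n"
  assumes V: "pos_def V" and \<sigma>: "\<sigma> \<noteq> 0" and Y: "elliptical M Y 0 (\<sigma>\<^sup>2 *\<^sub>R V) g"
    and T: "linear T" and inv: "\<And>x. T x \<bullet> (matrix_inv V *v T x) = x \<bullet> (matrix_inv V *v x)"
  shows "distr M borel (\<lambda>\<omega>. T (Y \<omega>)) = distr M borel Y"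
proof (rule measure_eqI)
  define f where "f = elliptical_density 0 (\<sigma>\<^sup>2 *\<^sub>R V) g"
  have D: "distributed M lborel Y (\<lambda>x. ennreal (f x))"
    using Y by (simp add: elliptical_def f_def)
  have [measurable]: "Y \<in> borel_measurable M" "(\<lambda>x. ennreal (f x)) \<in> borel_measurable borel"
    using D by (auto simp: distributed_def)
  have [measurable]: "T \<in> borel_measurable borel"
    by (intro borel_measurable_linear T)
  have f_T: "f (T x) = f x" for x
    using \<sigma> inv by (simp add: f_def elliptical_density_def matrix_inv_scaleR[OF pos_def_invertible[OF V]]
        scaleR_matrix_vector_assoc[symmetric])
  show "sets (distr M borel (\<lambda>\<omega>. T (Y \<omega>))) = sets (distr M borel Y)"
    by simp
  fix A assume "A \<in> sets (distr M borel (\<lambda>\<omega>. T (Y \<omega>)))"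
  then have [measurable]: "A \<in> sets borel"
    by simp
  have "emeasure (distr M borel (\<lambda>\<omega>. T (Y \<omega>))) A
      = (\<integral>\<^sup>+x. indicator A x \<partial>distr M borel (\<lambda>\<omega>. T (Y \<omega>)))"
    by simp
  also have "\<dots> = (\<integral>\<^sup>+\<omega>. indicator A (T (Y \<omega>)) \<partial>M)"
    by (rule nn_integral_distr) measurable
  also have "\<dots> = (\<integral>\<^sup>+x. ennreal (f x) * indicator A (T x) \<partial>lborel)"
    by (rule distributed_nn_integral[OF D, symmetric]) measurable
  \<comment> \<open>Now the whole integrand is a function of \<open>T x\<close>, and invariance of
    Lebesgue measure applies.\<close>
  also have "\<dots> = (\<integral>\<^sup>+x. ennreal (f (T x)) * indicator A (T x) \<partial>lborel)"
    by (simp add: f_T)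
  also have "\<dots> = (\<integral>\<^sup>+x. ennreal (f x) * indicator A x \<partial>lborel)"
    by (rule nn_integral_lborel_isometry[OF pos_def_matrix_inv[OF V] T inv]) measurable
  also have "\<dots> = (\<integral>\<^sup>+\<omega>. indicator A (Y \<omega>) \<partial>M)"
    by (rule distributed_nn_integral[OF D]) measurable
  also have "\<dots> = (\<integral>\<^sup>+x. indicator A x \<partial>distr M borel Y)"
    by (rule nn_integral_distr[symmetric]) measurable
  also have "\<dots> = emeasure (distr M borel Y) A"
    by simp
  finally show "emeasure (distr M borel (\<lambda>\<omega>. T (Y \<omega>))) A = emeasure (distr M borel Y) A" .
qed

lemma integrable_bilinear_of_second_moment:
  fixes Y :: "'a \<Rightarrow> 'b::euclidean_space" and a b :: "'b \<Rightarrow> 'c::euclidean_space"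
  assumes Y[measurable]: "Y \<in> borel_measurable M"
    and fin: "(\<integral>\<^sup>+\<omega>. ennreal ((norm (Y \<omega>))\<^sup>2) \<partial>M) < \<infinity>"
    and lin: "linear a" "linear b"
  shows "integrable M (\<lambda>\<omega>. a (Y \<omega>) \<bullet> b (Y \<omega>))"
proof -
  have [measurable]: "a \<in> borel_measurable borel" "b \<in> borel_measurable borel"
    by (intro borel_measurable_linear lin)+
  obtain Ka Kb where K: "0 < Ka" "\<And>x. norm (a x) \<le> Ka * norm x" "0 < Kb" "\<And>x. norm (b x) \<le> Kb * norm x"
    using lin by (metis linear_bounded_pos)
  have "integrable M (\<lambda>\<omega>. (norm (Y \<omega>))\<^sup>2)"
    using fin by (intro integrableI_bounded) simp_all
  then have "integrable M (\<lambda>\<omega>. Ka * Kb * (norm (Y \<omega>))\<^sup>2)"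
    by simp
  then show ?thesis
  proof (rule Bochner_Integration.integrable_bound)
    have "\<bar>a x \<bullet> b x\<bar> \<le> Ka * Kb * (norm x)\<^sup>2" for x
    proof -
      have "\<bar>a x \<bullet> b x\<bar> \<le> norm (a x) * norm (b x)"
        by (rule Cauchy_Schwarz_ineq2)
      also have "\<dots> \<le> (Ka * norm x) * (Kb * norm x)"
        using K by (intro mult_mono) (auto simp: less_imp_le)
      finally show ?thesis
        by (simp add: power2_eq_square mult_ac)
    qed
    then show "AE \<omega> in M. norm (a (Y \<omega>) \<bullet> b (Y \<omega>)) \<le> norm (Ka * Kb * (norm (Y \<omega>))\<^sup>2)"
      using K by (simp add: abs_mult)
  qed measurable
qed

theorem mainTheorem5:
  fixes M :: "'a measure"
    and X :: "real^'p^'n" and V :: "real^'n^'n"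
    and H :: "real^'p^'q" and h :: "real^'q"
    and Q :: "real^'p^'p"
    and g :: "real \<Rightarrow> real" and W :: "real set \<Rightarrow> real" and Wp Wm :: "real measure"
    and \<beta> :: "real^'p" and \<sigma> \<alpha> F\<^sub>\<alpha> :: real
    and \<epsilon> y :: "'a \<Rightarrow> real^'n"
  assumes model: "elliptical_regression M X V g W Wp Wm \<beta> \<sigma> \<epsilon> y"
    and H_rank: "CARD('q) < CARD('p)" "rank H = CARD('q)"
    and Q: "pos_def Q"
    and \<alpha>: "0 < \<alpha>" "\<alpha> < 1"
    and F\<^sub>\<alpha>: "measure (F_distribution CARD('q) (CARD('n) - CARD('p))) {F\<^sub>\<alpha><..} = \<alpha>"
    and H0: "H *v \<beta> = h"
  shows "quadratic_risk M Q (\<lambda>\<omega>. restricted_est X V H h (y \<omega>)) \<beta>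
           \<le> quadratic_risk M Q (\<lambda>\<omega>. preliminary_test_est X V H h F\<^sub>\<alpha> (y \<omega>)) \<beta> \<and>
         quadratic_risk M Q (\<lambda>\<omega>. preliminary_test_est X V H h F\<^sub>\<alpha> (y \<omega>)) \<beta>
           \<le> quadratic_risk M Q (\<lambda>\<omega>. unrestricted_est X V (y \<omega>)) \<beta>"
proof -
  have V: "pos_def V" and \<sigma>: "\<sigma> \<noteq> 0" and X: "rank X = CARD('p)"
    and y: "\<And>\<omega>. \<omega> \<in> space M \<Longrightarrow> y \<omega> = X *v \<beta> + \<epsilon> \<omega>"
    and ell: "elliptical M \<epsilon> 0 (\<sigma>\<^sup>2 *\<^sub>R V) g"
    using model by (auto simp: elliptical_regression_def)
  interpret restricted_regression X V H
    using X V H_rank by unfold_locales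
  \<comment> \<open>The estimation errors are \<open>w + u\<close> (unrestricted), \<open>w\<close>
    (restricted) and \<open>w + I u\<close> (preliminary test).\<close>
  define u where "u = correction"
  define w where "w e = unrestricted_est X V e - correction e" for e
  define I :: "real^'n \<Rightarrow> real" where
    "I e = indicator {z. test_stat X V H h z \<ge> F\<^sub>\<alpha>} (X *v \<beta> + e)" for e

  have [measurable]: "\<epsilon> \<in> borel_measurable M"
    using ell by (auto simp: elliptical_def distributed_def)
  have [measurable]: "test_stat X V H h \<in> borel_measurable borel"
    by (rule borel_measurable_test_stat)
  have [measurable]: "I \<in> borel_measurable borel"
    unfolding I_def indicator_def by measurable
  have linear: "linear u" "linear w" "linear (\<lambda>e. Q *v u e)" "linear (\<lambda>e. Q *v w e)"
    unfolding u_def w_def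
    by (intro linear_correction linear_compose_sub linear_unrestricted_est
        linear_compose[unfolded o_def, OF _ matrix_vector_mul_linear])+
  have [measurable]: "a \<in> borel_measurable borel"
    if "linear a" for a :: "real^'n \<Rightarrow> real^'p"
    by (intro borel_measurable_linear that)
  have int: "integrable M (\<lambda>\<omega>. a (\<epsilon> \<omega>) \<bullet> b (\<epsilon> \<omega>))" if "linear a" "linear b" for a b :: "real^'n \<Rightarrow> real^'p"
    using elliptical_regression_second_moment_finite[OF model] that
    by (intro integrable_bilinear_of_second_moment) auto
  have int_I: "integrable M (\<lambda>\<omega>. I (\<epsilon> \<omega>) * (a (\<epsilon> \<omega>) \<bullet> b (\<epsilon> \<omega>)))"
    if "linear a" "linear b" for a b :: "real^'n \<Rightarrow> real^'p"
    by (rule Bochner_Integration.integrable_bound[OF int[OF that]])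
      (use that in \<open>auto simp: I_def indicator_def\<close>)

  have [measurable]: "reflection \<in> borel_measurable borel"
    by (intro borel_measurable_linear linear_reflection)
  \<comment> \<open>Invariance of the law equates the mean of an odd function with its own
    negative.\<close>
  have odd: "(LINT \<omega>|M. c (\<epsilon> \<omega>)) = 0"
    if [measurable]: "c \<in> borel_measurable borel" and c: "\<And>e. c (reflection e) = - c e"
    for c :: "real^'n \<Rightarrow> real"
  proof -
    have "(LINT \<omega>|M. c (\<epsilon> \<omega>)) = (LINT e|distr M borel \<epsilon>. c e)"
      by (subst integral_distr) auto
    also have "\<dots> = (LINT e|distr M borel (\<lambda>\<omega>. reflection (\<epsilon> \<omega>)). c e)"
      by (simp add: elliptical_distr_isometry[OF V \<sigma> ell linear_reflection reflection_isometry])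
    also have "\<dots> = (LINT \<omega>|M. c (reflection (\<epsilon> \<omega>)))"
      by (subst integral_distr) auto
    also have "\<dots> = - (LINT \<omega>|M. c (\<epsilon> \<omega>))"
      by (simp add: c)
    finally show ?thesis
      by simp
  qed
  have u_reflection: "u (reflection e) = - u e" and w_reflection: "w (reflection e) = w e"
    and I_reflection: "I (reflection e) = I e" for e
    unfolding u_def w_def I_def indicator_def correction_reflection unrestricted_est_reflection scaleR_2
    by (simp_all add: test_stat_reflection[OF H0])
  \<comment> \<open>Under the reflection only \<open>u\<close> changes sign, so both integrands are
    odd.\<close>
  have cross: "(LINT \<omega>|M. w (\<epsilon> \<omega>) \<bullet> (Q *v u (\<epsilon> \<omega>))) = 0"
    "(LINT \<omega>|M. I (\<epsilon> \<omega>) * (w (\<epsilon> \<omega>) \<bullet> (Q *v u (\<epsilon> \<omega>)))) = 0"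
    by (intro odd; use linear in \<open>simp add: u_reflection w_reflection I_reflection
        linear_neg[OF matrix_vector_mul_linear]\<close>)+

  \<comment> \<open>Symmetry of \<open>Q\<close> merges the two mixed terms of each expanded square
    into one with factor 2.\<close>
  have Q_sym: "u e \<bullet> (Q *v w e) = w e \<bullet> (Q *v u e)" for e
    using pos_def_symmetric[OF Q] by (metis inner_commute inner_matrix_vector)
  have "(LINT \<omega>|M. I (\<epsilon> \<omega>) * (u (\<epsilon> \<omega>) \<bullet> (Q *v u (\<epsilon> \<omega>)))) \<ge> 0"
    by (intro integral_nonneg_AE) (simp add: I_def pos_def_nonneg[OF Q])
  moreover have "(LINT \<omega>|M. I (\<epsilon> \<omega>) * (u (\<epsilon> \<omega>) \<bullet> (Q *v u (\<epsilon> \<omega>))))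
      \<le> (LINT \<omega>|M. u (\<epsilon> \<omega>) \<bullet> (Q *v u (\<epsilon> \<omega>)))"
    by (intro integral_mono int int_I linear) (simp add: I_def indicator_def pos_def_nonneg[OF Q])
  moreover have "quadratic_risk M Q (\<lambda>\<omega>. restricted_est X V H h (y \<omega>)) \<beta>
      = (LINT \<omega>|M. w (\<epsilon> \<omega>) \<bullet> (Q *v w (\<epsilon> \<omega>)))"
    unfolding quadratic_risk_def
    by (intro Bochner_Integration.integral_cong refl)
      (simp add: y restricted_est_model[OF H0] w_def)
  moreover have "quadratic_risk M Q (\<lambda>\<omega>. unrestricted_est X V (y \<omega>)) \<beta>
      = (LINT \<omega>|M. w (\<epsilon> \<omega>) \<bullet> (Q *v w (\<epsilon> \<omega>)) + 2 * (w (\<epsilon> \<omega>) \<bullet> (Q *v u (\<epsilon> \<omega>)))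
          + u (\<epsilon> \<omega>) \<bullet> (Q *v u (\<epsilon> \<omega>)))"
    unfolding quadratic_risk_def
  proof (intro Bochner_Integration.integral_cong refl)
    fix \<omega> assume "\<omega> \<in> space M"
    then have "unrestricted_est X V (y \<omega>) - \<beta> = w (\<epsilon> \<omega>) + u (\<epsilon> \<omega>)"
      by (simp add: y unrestricted_est_model w_def u_def)
    then show "(unrestricted_est X V (y \<omega>) - \<beta>) \<bullet> (Q *v (unrestricted_est X V (y \<omega>) - \<beta>))
        = w (\<epsilon> \<omega>) \<bullet> (Q *v w (\<epsilon> \<omega>)) + 2 * (w (\<epsilon> \<omega>) \<bullet> (Q *v u (\<epsilon> \<omega>)))
          + u (\<epsilon> \<omega>) \<bullet> (Q *v u (\<epsilon> \<omega>))"
      by (simp add: matrix_vector_right_distrib inner_add_left inner_add_right Q_sym)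
  qed
  moreover have "quadratic_risk M Q (\<lambda>\<omega>. preliminary_test_est X V H h F\<^sub>\<alpha> (y \<omega>)) \<beta>
      = (LINT \<omega>|M. w (\<epsilon> \<omega>) \<bullet> (Q *v w (\<epsilon> \<omega>)) + 2 * (I (\<epsilon> \<omega>) * (w (\<epsilon> \<omega>) \<bullet> (Q *v u (\<epsilon> \<omega>))))
          + I (\<epsilon> \<omega>) * (u (\<epsilon> \<omega>) \<bullet> (Q *v u (\<epsilon> \<omega>))))"
    unfolding quadratic_risk_def
  proof (intro Bochner_Integration.integral_cong refl)
    fix \<omega> assume "\<omega> \<in> space M"
    then have "preliminary_test_est X V H h F\<^sub>\<alpha> (y \<omega>) - \<beta> = w (\<epsilon> \<omega>) + I (\<epsilon> \<omega>) *\<^sub>R u (\<epsilon> \<omega>)"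
      by (simp add: y preliminary_test_est_model[OF H0] w_def u_def I_def)
    then show "(preliminary_test_est X V H h F\<^sub>\<alpha> (y \<omega>) - \<beta>)
          \<bullet> (Q *v (preliminary_test_est X V H h F\<^sub>\<alpha> (y \<omega>) - \<beta>))
        = w (\<epsilon> \<omega>) \<bullet> (Q *v w (\<epsilon> \<omega>)) + 2 * (I (\<epsilon> \<omega>) * (w (\<epsilon> \<omega>) \<bullet> (Q *v u (\<epsilon> \<omega>))))
          + I (\<epsilon> \<omega>) * (u (\<epsilon> \<omega>) \<bullet> (Q *v u (\<epsilon> \<omega>)))"
      \<comment> \<open>Being an indicator, \<open>I\<close> equals its own square.\<close>
      by (simp add: I_def indicator_def matrix_vector_right_distrib inner_add_left inner_add_right Q_sym)
  qed
  \<comment> \<open>Integrability permits splitting the integrals. Without the cross terms, the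
    risks exceed that of the restricted estimator by 0, E[I u'Qu] and E[u'Qu].\<close>
  ultimately show ?thesis
    using int[OF linear(2,4)] int[OF linear(2,3)] int[OF linear(1,3)]
      int_I[OF linear(2,3)] int_I[OF linear(1,3)]
    by (simp add: cross)
qed

end
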